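(* Let $\Gamma\in\mathbb{R}^{p\times p}$ be a continuous-time interconnection (not necessarily connected). There exists $\alpha>0$ such that for every Riemann-integrable $Q:\mathbb{R}_{\ge0}\to\mathcal Q_n$, the solution $\mathbf x(\cdot)$ of $\dot{\mathbf x}=(\Gamma\otimes Q_t)\mathbf x$, $\mathbf x\in\mathbb{R}^{np}$, satisfies $|\mathbf x(t)|\le\alpha|\mathbf x(0)|$ for all $t\ge0$.
   Context: $|\cdot|$ is the Euclidean norm; $\otimes$ is the Kronecker product; $\mathcal Q_n$ is the set of symmetric positive semidefinite $n\times n$ real matrices. A continuous-time interconnection is $\Gamma=[\gamma_{ij}]$ with $\gamma_{ij}\ge0$ for $i\ne j$ and $\gamma_{ii}=-\sum_{j\ne i}\gamma_{ij}$. Equivalently, writing $\mathbf x=[x_1^T\cdots x_p^T]^T$, the system is $\dot x_i=Q_t\sum_{j\ne i}\gamma_{ij}(x_j-x_i)$. *)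

theory Defs
  imports "HOL-Analysis.Analysis"
begin

definition ct_interconnection :: "real^'p^'p \<Rightarrow> bool" where
  "ct_interconnection G \<longleftrightarrow>
     (\<forall>i j. i \<noteq> j \<longrightarrow> G$i$j \<ge> 0) \<and>
     (\<forall>i. G$i$i = - (\<Sum>j\<in>UNIV - {i}. G$i$j))"

definition psd_sym :: "real^'n^'n \<Rightarrow> bool" where
  "psd_sym M \<longleftrightarrow> transpose M = M \<and> (\<forall>v. 0 \<le> v \<bullet> (M *v v))"

text \<open>Kronecker product, indexing R^(np) by pairs (block index, inner index).\<close>
definition kron :: "real^'p^'p \<Rightarrow> real^'n^'n \<Rightarrow> real^('p \<times> 'n)^('p \<times> 'n)" where
  "kron A B = (\<chi> r. \<chi> c. A$fst r$fst c * B$snd r$snd c)"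

definition riemann_integrable_on ::
  "(real \<Rightarrow> 'a::real_normed_vector) \<Rightarrow> real \<Rightarrow> real \<Rightarrow> bool" where
  "riemann_integrable_on f a b \<longleftrightarrow>
     (\<exists>I. \<forall>e>0. \<exists>d>0. \<forall>D. D tagged_division_of {a..b} \<and>
         (\<forall>(t,K)\<in>D. diameter K < d) \<longrightarrow>
         norm ((\<Sum>(t,K)\<in>D. Henstock_Kurzweil_Integration.content K *\<^sub>R f t) - I) < e)"

end

theory Submission
  imports Defs
begin

text \<open>
  The matrix \<open>R = 1 + c G\<close> is row stochastic for small \<open>c > 0\<close>, hence power bounded. With
  \<open>S = (1 + R) / 2\<close> and \<open>D = R - 1\<close>, the binomial expansion of \<open>S ^ k D\<close> has coefficients of
  total mass \<open>O(1 / sqrt k)\<close>, so some \<open>S ^ N\<close> does not increase the norm on the range of \<open>D\<close>.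
  Then \<open>(\<Sum>k<N. |S ^ k D x|\<^sup>2)\<close>, completed by squares of linear functionals spanning the
  annihilator of the range of \<open>D\<close>, is a positive definite quadratic form, and its polarisation
  \<open>B\<close> satisfies \<open>B x (G x) \<le> 0\<close>. Writing \<open>Q\<close> as a sum of rank-one matrices shows that
  \<open>B \<otimes> 1\<close> is a Lyapunov form for \<open>G \<otimes> Q\<close> whatever the positive semidefinite \<open>Q\<close> is, so
  the bound depends on \<open>G\<close> only.
\<close>

section \<open>Averages of power-bounded linear maps\<close>

lemma linear_funpow:
  fixes f :: "'a::real_vector \<Rightarrow> 'a"
  assumes "linear f"
  shows "linear (f ^^ k)"
proof (induction k)
  case 0
  show ?case by (simp add: linear_iff)
next
  case (Suc k)
  then show ?case
    using linear_compose[OF Suc assms] by (simp add: o_def)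
qed

text \<open>Under the symmetric binomial distribution \<open>2 * j - n\<close> has variance
  \<open>n\<close>, so its mean absolute value is at most the standard deviation
  \<open>sqrt n\<close>. The probabilities are Bernstein polynomials at 1/2, whose moments are
  known.\<close>

lemma sum_binomial_abs_deviation:
  "(\<Sum>j\<le>n. \<bar>2 * real j - real n\<bar> * real (n choose j)) \<le> 2 ^ n * sqrt (real n)"
proof (cases "n = 0")
  case False
  have half: "Bernstein n j (1/2) = real (n choose j) / 2 ^ n" if "j \<le> n" for j
    using that by (simp add: Bernstein_def power_divide flip: power_add)
  \<comment> \<open>Writing the square in terms of \<open>j * (j - 1)\<close>, \<open>j\<close> and
    \<open>1\<close> matches the factorial moments of the Bernstein polynomials.\<close>
  have "(\<Sum>j\<le>n. (2 * real j - real n)\<^sup>2 * Bernstein n j (1/2)) =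
        (\<Sum>j\<le>n. 4 * (real j * (real j - 1) * Bernstein n j (1/2))
               + (4 - 4 * real n) * (real j * Bernstein n j (1/2))
               + (real n)\<^sup>2 * Bernstein n j (1/2))"
    by (intro sum.cong refl) (simp add: power2_eq_square algebra_simps)
  also have "\<dots> = 4 * (real n * (real n - 1) * (1/2)\<^sup>2) + (4 - 4 * real n) * (real n * (1/2))
      + (real n)\<^sup>2 * 1"
    by (simp only: sum.distrib flip: sum_distrib_left)
       (simp only: sum_k_Bernstein sum_kk_Bernstein sum_Bernstein)
  also have "\<dots> = real n"
    by (simp add: power2_eq_square algebra_simps)
  finally have variance: "(\<Sum>j\<le>n. (2 * real j - real n)\<^sup>2 * Bernstein n j (1/2)) = real n" .
  \<comment> \<open>The weight \<open>sqrt n\<close> balances the two terms: after averaging, each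
    contributes \<open>sqrt n / 2\<close>.\<close>
  have am_gm: "\<bar>a\<bar> \<le> a\<^sup>2 / (2 * sqrt n) + sqrt n / 2" for a :: real
  proof -
    have "0 \<le> (\<bar>a\<bar> - sqrt n)\<^sup>2" by simp
    also have "\<dots> = a\<^sup>2 + sqrt n * sqrt n - 2 * \<bar>a\<bar> * sqrt n"
      by (simp add: power2_eq_square algebra_simps)
    finally show ?thesis
      using False by (simp add: field_simps power2_eq_square)
  qed
  have "(\<Sum>j\<le>n. \<bar>2 * real j - real n\<bar> * Bernstein n j (1/2)) \<le>
        (\<Sum>j\<le>n. ((2 * real j - real n)\<^sup>2 / (2 * sqrt n) + sqrt n / 2) * Bernstein n j (1/2))"
    by (intro sum_mono mult_right_mono am_gm Bernstein_nonneg) auto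
  also have "\<dots> = (\<Sum>j\<le>n. (2 * real j - real n)\<^sup>2 * Bernstein n j (1/2)) / (2 * sqrt n)
      + sqrt n / 2 * (\<Sum>j\<le>n. Bernstein n j (1/2))"
    by (simp only: sum.distrib sum_distrib_left sum_divide_distrib distrib_right) simp
  also have "\<dots> = sqrt n"
    unfolding variance using False by (simp add: field_simps)
  finally have "(\<Sum>j\<le>n. \<bar>2 * real j - real n\<bar> * (real (n choose j) / 2 ^ n)) \<le> sqrt n"
    using half by simp
  then show ?thesis
    by (simp add: field_simps flip: sum_divide_distrib)
qed simp

lemma funpow_average_expansion:
  fixes R :: "'a::real_vector \<Rightarrow> 'a"
  assumes R: "linear R"
  shows "2 ^ k *\<^sub>R ((\<lambda>v. (1/2) *\<^sub>R (v + R v)) ^^ k) v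
         = (\<Sum>j\<le>k. real (k choose j) *\<^sub>R (R ^^ j) v)"
proof (induction k arbitrary: v)
  case (Suc k)
  define S where "S = (\<lambda>v. (1/2) *\<^sub>R (v + R v))"
  interpret Rj: linear "R ^^ j" for j
    by (rule linear_funpow[OF R])
  have "2 ^ Suc k *\<^sub>R (S ^^ Suc k) v = 2 *\<^sub>R (2 ^ k *\<^sub>R (S ^^ k) (S v))"
    by (simp add: funpow_swap1)
  also have "\<dots> = (\<Sum>j\<le>k. (2 * real (k choose j)) *\<^sub>R (R ^^ j) (S v))"
    using Suc.IH[of "S v"] by (simp add: S_def scaleR_sum_right)
  also have "\<dots> = (\<Sum>j\<le>k. real (k choose j) *\<^sub>R (R ^^ j) v + real (k choose j) *\<^sub>R (R ^^ Suc j) v)"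
    by (intro sum.cong refl) (simp add: S_def Rj.scale Rj.add scaleR_add_right funpow_swap1)
  \<comment> \<open>The first sum may run to \<open>Suc k\<close> because
    \<open>k choose Suc k = 0\<close>; after an index shift in the second, Pascal's rule merges the
    two.\<close>
  also have "\<dots> = (\<Sum>j\<le>Suc k. real (k choose j) *\<^sub>R (R ^^ j) v)
      + (\<Sum>j\<le>k. real (k choose j) *\<^sub>R (R ^^ Suc j) v)"
    by (simp add: sum.distrib)
  also have "\<dots> = (\<Sum>j\<le>Suc k. real (Suc k choose j) *\<^sub>R (R ^^ j) v)"
    by (simp only: sum.atMost_Suc_shift) (simp add: sum.distrib scaleR_add_left)
  finally show ?case by (simp add: S_def)
qed simp

text \<open>In \<open>(1 + R) ^ k (R - 1)\<close> the coefficient of \<open>R ^ j\<close> is the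
  difference of the neighbouring binomials \<open>k choose (j - 1)\<close> and
  \<open>k choose j\<close>. Multiplication by \<open>Suc k\<close> and the two absorption
  identities turn it into the weight estimated in \<open>sum_binomial_abs_deviation\<close>.\<close>

lemma funpow_average_difference_expansion:
  fixes R :: "'a::real_vector \<Rightarrow> 'a"
  assumes R: "linear R"
  shows "(real (Suc k) * 2 ^ k) *\<^sub>R ((\<lambda>v. (1/2) *\<^sub>R (v + R v)) ^^ k) (R v - v)
         = (\<Sum>j\<le>Suc k. ((2 * real j - real (Suc k)) * real (Suc k choose j)) *\<^sub>R (R ^^ j) v)"
proof -
  interpret Rj: linear "R ^^ j" for j
    by (rule linear_funpow[OF R])
  \<comment> \<open>The case distinction is needed because natural subtraction would turn
    \<open>k choose (0 - 1)\<close> into 1.\<close>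
  have up: "real j * real (Suc k choose j) = real (Suc k) * (if j = 0 then 0 else real (k choose (j - 1)))"
    for j
    using times_binomial_minus1_eq[of j "Suc k"]
    by (cases "j = 0") (simp_all del: of_nat_Suc binomial_Suc_Suc mult_Suc flip: of_nat_mult)
  have down: "(real (Suc k) - real j) * real (Suc k choose j) = real (Suc k) * real (k choose j)"
    if "j \<le> Suc k" for j
    using arg_cong[OF binomial_absorb_comp[of "Suc k" j], of real] that
    by (simp only: of_nat_mult of_nat_diff diff_Suc_1)
  have "(\<Sum>j\<le>Suc k. ((2 * real j - real (Suc k)) * real (Suc k choose j)) *\<^sub>R (R ^^ j) v)
      = (\<Sum>j\<le>Suc k. (real j * real (Suc k choose j)) *\<^sub>R (R ^^ j) v
          - ((real (Suc k) - real j) * real (Suc k choose j)) *\<^sub>R (R ^^ j) v)"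
    by (intro sum.cong refl) (simp add: algebra_simps flip: scaleR_left_distrib scaleR_diff_left)
  also have "\<dots> = (\<Sum>j\<le>Suc k. (real (Suc k) * (if j = 0 then 0 else real (k choose (j - 1)))) *\<^sub>R (R ^^ j) v
          - (real (Suc k) * real (k choose j)) *\<^sub>R (R ^^ j) v)"
    using down by (intro sum.cong refl) (simp only: up atMost_iff)
  also have "\<dots> = (\<Sum>j\<le>Suc k. (real (Suc k) * (if j = 0 then 0 else real (k choose (j - 1)))) *\<^sub>R (R ^^ j) v)
          - (\<Sum>j\<le>Suc k. (real (Suc k) * real (k choose j)) *\<^sub>R (R ^^ j) v)"
    by (rule sum_subtractf)
  also have "(\<Sum>j\<le>Suc k. (real (Suc k) * (if j = 0 then 0 else real (k choose (j - 1)))) *\<^sub>R (R ^^ j) v)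
      = (\<Sum>j\<le>k. (real (Suc k) * real (k choose j)) *\<^sub>R (R ^^ Suc j) v)"
    by (subst sum.atMost_Suc_shift) simp
  also have "(\<Sum>j\<le>Suc k. (real (Suc k) * real (k choose j)) *\<^sub>R (R ^^ j) v)
      = (\<Sum>j\<le>k. (real (Suc k) * real (k choose j)) *\<^sub>R (R ^^ j) v)"
    by simp
  also have "(\<Sum>j\<le>k. (real (Suc k) * real (k choose j)) *\<^sub>R (R ^^ Suc j) v)
      - (\<Sum>j\<le>k. (real (Suc k) * real (k choose j)) *\<^sub>R (R ^^ j) v)
      = real (Suc k) *\<^sub>R (\<Sum>j\<le>k. real (k choose j) *\<^sub>R (R ^^ j) (R v - v))"
    by (simp only: scaleR_sum_right flip: sum_subtractf)
       (simp add: Rj.diff scaleR_diff_right funpow_swap1)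
  also have "\<dots> = real (Suc k) *\<^sub>R 2 ^ k *\<^sub>R ((\<lambda>v. (1/2) *\<^sub>R (v + R v)) ^^ k) (R v - v)"
    by (simp only: funpow_average_expansion[OF R])
  finally show ?thesis by simp
qed

text \<open>With \<open>n = Suc k\<close>, the coefficients of the expansion have absolute sum at
  most \<open>2 ^ n * sqrt n\<close>; division by \<open>n * 2 ^ k\<close> leaves
  \<open>2 / sqrt n\<close>.\<close>

lemma power_bounded_average_difference_decay:
  fixes R :: "'a::real_normed_vector \<Rightarrow> 'a"
  assumes R: "linear R" and bound: "\<And>k v. norm ((R ^^ k) v) \<le> C * norm v"
  shows "norm (((\<lambda>v. (1/2) *\<^sub>R (v + R v)) ^^ k) (R v - v)) \<le> 2 * C * norm v / sqrt (Suc k)"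
proof -
  define n where "n = Suc k"
  let ?u = "((\<lambda>v. (1/2) *\<^sub>R (v + R v)) ^^ k) (R v - v)"
  have Cv: "0 \<le> C * norm v"
    using bound[of 0 v] by (simp add: order_trans[OF norm_ge_zero])
  have "(real n * 2 ^ k) * norm ?u = norm ((real n * 2 ^ k) *\<^sub>R ?u)"
    by simp
  also have "\<dots> = norm (\<Sum>j\<le>n. ((2 * real j - real n) * real (n choose j)) *\<^sub>R (R ^^ j) v)"
    unfolding n_def by (simp only: funpow_average_difference_expansion[OF R])
  also have "\<dots> \<le> (\<Sum>j\<le>n. (\<bar>2 * real j - real n\<bar> * real (n choose j)) * (C * norm v))"
    by (intro sum_norm_le) (auto simp: abs_mult intro!: mult_left_mono bound)
  also have "\<dots> = (\<Sum>j\<le>n. \<bar>2 * real j - real n\<bar> * real (n choose j)) * (C * norm v)"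
    by (simp add: sum_distrib_right)
  also have "\<dots> \<le> (2 ^ n * sqrt n) * (C * norm v)"
    by (intro mult_right_mono sum_binomial_abs_deviation Cv)
  finally have "2 ^ k * (real n * norm ?u) \<le> 2 ^ k * (2 * sqrt n * (C * norm v))"
    by (simp add: n_def ac_simps)
  then have "sqrt n * (sqrt n * norm ?u) \<le> sqrt n * (2 * C * norm v)"
    by (simp add: ac_simps) (simp add: n_def mult.assoc[symmetric] del: of_nat_Suc)
  then have "sqrt n * norm ?u \<le> 2 * C * norm v"
    by (rule mult_left_le_imp_le) (simp add: n_def)
  then show ?thesis
    by (simp add: n_def field_simps)
qed

text \<open>The orbit of \<open>y\<close> advances by the fixed vector \<open>x\<close> at every
  step, so it would grow linearly if \<open>x\<close> were nonzero.\<close>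

lemma power_bounded_range_Int_kernel:
  fixes R :: "'a::real_normed_vector \<Rightarrow> 'a"
  assumes R: "linear R" and bound: "\<And>k v. norm ((R ^^ k) v) \<le> C * norm v"
    and x: "x = R y - y" and fixed: "R x = x"
  shows "x = 0"
proof (rule ccontr)
  assume "x \<noteq> 0"
  have orbit: "(R ^^ k) y = y + real k *\<^sub>R x" for k
  proof (induction k)
    case (Suc k)
    have "(R ^^ Suc k) y = R y + real k *\<^sub>R R x"
      by (simp add: Suc linear_add[OF R] linear_scale[OF R])
    also have "\<dots> = y + real (Suc k) *\<^sub>R x"
      unfolding fixed using x by (simp add: algebra_simps)
    finally show ?case .
  qed simp
  obtain k where k: "real k * norm x > C * norm y + norm y"
    using ex_less_of_nat_mult[of "norm x" "C * norm y + norm y"] \<open>x \<noteq> 0\<close> by auto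
  have "real k * norm x = norm ((R ^^ k) y - y)"
    by (simp add: orbit)
  also have "\<dots> \<le> C * norm y + norm y"
    by (rule order_trans[OF norm_triangle_ineq4]) (simp add: bound)
  finally show False using k by simp
qed

text \<open>The decay estimate is in terms of the argument of \<open>D = R - 1\<close>. On the
  orthogonal complement of its kernel \<open>D\<close> is bounded below, which converts the estimate
  into one in terms of the value of \<open>D\<close>.\<close>

lemma power_bounded_average_contraction_on_range:
  fixes R :: "'a::euclidean_space \<Rightarrow> 'a"
  assumes R: "linear R" and bound: "\<And>k v. norm ((R ^^ k) v) \<le> C * norm v"
  obtains N where "N > 0"
    "\<And>x. norm (((\<lambda>v. (1/2) *\<^sub>R (v + R v)) ^^ N) (R x - x)) \<le> norm (R x - x)"
proof -
  define D where "D = (\<lambda>x. R x - x)"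
  have D: "linear D"
    using R by (simp add: D_def linear_iff algebra_simps)
  let ?K = "{x. D x = 0}"
  have K: "subspace ?K"
    by (rule linear_subspace_kernel[OF D])
  have "\<forall>x\<in>?K\<^sup>\<bottom>. D x = 0 \<longrightarrow> x = 0"
    by (auto simp: orthogonal_comp_def orthogonal_def dest!: bspec)
  then obtain e where e: "e > 0" "\<And>x. x \<in> ?K\<^sup>\<bottom> \<Longrightarrow> e * norm x \<le> norm (D x)"
    using injective_imp_isometric[OF closed_subspace[OF subspace_orthogonal_comp] subspace_orthogonal_comp
        linear_conv_bounded_linear[THEN iffD1, OF D], of ?K] by blast
  \<comment> \<open>This \<open>N\<close> brings the decay factor
    \<open>2 * C / sqrt (Suc N)\<close> below the lower bound \<open>e\<close> of
    \<open>D\<close>.\<close>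
  obtain N :: nat where N: "(2 * \<bar>C\<bar> / e)\<^sup>2 < real N"
    using reals_Archimedean2 by blast
  show thesis
  proof
    show "N > 0"
      using N by (metis le_less_trans of_nat_0_less_iff zero_le_power2)
    fix x
    obtain z y where zy: "D z = 0" "y \<in> ?K\<^sup>\<bottom>" "x = z + y"
    proof (rule set_plus_elim[of x ?K "?K\<^sup>\<bottom>"])
      show "x \<in> ?K + ?K\<^sup>\<bottom>"
        by (simp add: subspace_sum_orthogonal_comp[OF K])
    qed auto
    have Dx: "D x = D y"
      using zy by (simp add: linear_add[OF D])
    have "2 * \<bar>C\<bar> / e \<le> sqrt (real (Suc N))"
      using N by (intro real_le_rsqrt) simp
    then have q: "2 * \<bar>C\<bar> / sqrt (Suc N) \<le> e"
      using e(1) by (simp add: field_simps)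
    have "norm (((\<lambda>v. (1/2) *\<^sub>R (v + R v)) ^^ N) (D y)) \<le> 2 * C * norm y / sqrt (Suc N)"
      unfolding D_def by (rule power_bounded_average_difference_decay[OF R bound])
    also have "\<dots> \<le> 2 * \<bar>C\<bar> / sqrt (Suc N) * norm y"
      by (simp add: divide_right_mono mult_right_mono)
    also have "\<dots> \<le> e * norm y"
      by (rule mult_right_mono[OF q]) simp
    also have "\<dots> \<le> norm (D y)"
      by (rule e(2)[OF zy(2)])
    finally show "norm (((\<lambda>v. (1/2) *\<^sub>R (v + R v)) ^^ N) (R x - x)) \<le> norm (R x - x)"
      using Dx by (simp add: D_def)
  qed
qed

section \<open>Quadratic Lyapunov forms\<close>

lemma power_bounded_Lyapunov_form:
  fixes R :: "'a::euclidean_space \<Rightarrow> 'a"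
  assumes R: "linear R" and bound: "\<And>k v. norm ((R ^^ k) v) \<le> C * norm v"
  obtains B :: "'a \<Rightarrow> 'a \<Rightarrow> real" where
    "bilinear B" "\<And>x y. B x y = B y x" "\<And>x. x \<noteq> 0 \<Longrightarrow> 0 < B x x" "\<And>x. B x (R x - x) \<le> 0"
proof -
  define S where "S = (\<lambda>v. (1/2) *\<^sub>R (v + R v))"
  define D where "D = (\<lambda>x. R x - x)"
  obtain N where N: "N > 0" "\<And>x. norm ((S ^^ N) (D x)) \<le> norm (D x)"
    using power_bounded_average_contraction_on_range[OF R bound] unfolding S_def D_def by metis
  have D: "linear D" and S: "linear S"
    using R by (simp_all add: D_def S_def linear_iff algebra_simps)
  have SD: "linear (\<lambda>x. (S ^^ k) (D x))" for k
    using linear_compose[OF D linear_funpow[OF S]] by (simp add: o_def)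
  obtain F where F: "F \<subseteq> (range D)\<^sup>\<bottom>" "finite F" "(range D)\<^sup>\<bottom> \<subseteq> span F"
    using basis_exists[of "(range D)\<^sup>\<bottom>"] finiteI_independent by metis
  \<comment> \<open>As \<open>N > 0\<close>, the first sum on the diagonal contains the square of
    \<open>norm (D x)\<close> and vanishes exactly on the kernel of \<open>D\<close>. The second sum
    makes the form definite and adds nothing to \<open>B x (D x)\<close>, since each
    \<open>b\<close> annihilates the range of \<open>D\<close>.\<close>
  define B where "B = (\<lambda>x y. (\<Sum>k<N. (S ^^ k) (D x) \<bullet> (S ^^ k) (D y)) + (\<Sum>b\<in>F. (b \<bullet> x) * (b \<bullet> y)))"
  have FD: "b \<bullet> D x = 0" if "b \<in> F" for b x
    using F(1) that by (auto simp: orthogonal_comp_def orthogonal_def inner_commute)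
  show thesis
  proof
    show "bilinear B"
      unfolding bilinear_def
    proof (intro conjI allI)
      show "linear (B x)" for x
        by (rule linearI)
           (simp_all add: B_def linear_add[OF SD] linear_scale[OF SD] inner_right_distrib
             sum.distrib sum_distrib_left distrib_left mult.left_commute)
      show "linear (\<lambda>x. B x y)" for y
        by (rule linearI)
           (simp_all add: B_def linear_add[OF SD] linear_scale[OF SD] inner_left_distrib inner_right_distrib
             sum.distrib sum_distrib_left distrib_left distrib_right mult.assoc)
    qed
    show "B x y = B y x" for x y
      by (simp add: B_def inner_commute mult.commute)
    show "0 < B x x" if "x \<noteq> 0" for x
    proof (rule ccontr)
      assume "\<not> 0 < B x x"
      moreover have "0 \<le> (\<Sum>k<N. (S ^^ k) (D x) \<bullet> (S ^^ k) (D x))" "0 \<le> (\<Sum>b\<in>F. (b \<bullet> x) * (b \<bullet> x))"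
        by (simp_all add: sum_nonneg)
      ultimately have zero: "(\<Sum>k<N. (S ^^ k) (D x) \<bullet> (S ^^ k) (D x)) = 0" "(\<Sum>b\<in>F. (b \<bullet> x) * (b \<bullet> x)) = 0"
        by (simp_all add: B_def)
      then have Dx: "D x = 0"
        using N(1) by (auto simp: sum_nonneg_eq_0_iff dest: bspec[where x=0])
      have "b \<bullet> x = 0" if "b \<in> F" for b
        using zero(2) that F(2) by (simp add: sum_nonneg_eq_0_iff)
      then have "orthogonal x b" if "b \<in> (range D)\<^sup>\<bottom>" for b
        using orthogonal_to_span[of b F x] that F(3) by (auto simp: orthogonal_def inner_commute)
      \<comment> \<open>Orthogonality to the whole annihilator puts \<open>x\<close> back into the
        range of \<open>D\<close>, which meets the kernel only in 0.\<close>
      then have "x \<in> (range D)\<^sup>\<bottom>\<^sup>\<bottom>"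
        by (auto simp: orthogonal_comp_def orthogonal_commute)
      then have "x \<in> range D"
        using orthogonal_comp_self[OF linear_subspace_image[OF D subspace_UNIV]] by simp
      then show False
        using power_bounded_range_Int_kernel[OF R bound, of x] Dx that by (auto simp: D_def)
    qed
    show "B x (R x - x) \<le> 0" for x
    proof -
      define z where "z k = (S ^^ k) (D x)" for k
      have commute: "(S ^^ k) (D u) = D ((S ^^ k) u)" for k u
      proof (induction k)
        case (Suc k)
        have "S (D w) = D (S w)" for w
          by (simp add: S_def D_def linear_add[OF R] linear_scale[OF R] linear_diff[OF R] algebra_simps)
        with Suc show ?case by simp
      qed simp
      \<comment> \<open>Since \<open>D = 2 (S - 1)\<close>, the left side is
        \<open>2 * (z k \<bullet> (z (Suc k) - z k))\<close>, which is the right side minus the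
        squared norm of \<open>z (Suc k) - z k\<close>. The right side telescopes, and the choice of
        \<open>N\<close> gives the sign.\<close>
      have step: "z k \<bullet> (S ^^ k) (D (D x)) \<le> (norm (z (Suc k)))\<^sup>2 - (norm (z k))\<^sup>2" for k
      proof -
        have "(S ^^ k) (D (D x)) = 2 *\<^sub>R (z (Suc k) - z k)"
          unfolding commute[of k "D x"] z_def by (simp add: S_def D_def algebra_simps scaleR_2)
        moreover have "0 \<le> (z (Suc k) - z k) \<bullet> (z (Suc k) - z k)"
          by simp
        ultimately show ?thesis
          by (simp add: power2_norm_eq_inner inner_diff_left inner_diff_right inner_commute)
      qed
      have "B x (D x) = (\<Sum>k<N. z k \<bullet> (S ^^ k) (D (D x)))"
        by (simp add: B_def z_def FD)
      also have "\<dots> \<le> (\<Sum>k<N. (norm (z (Suc k)))\<^sup>2 - (norm (z k))\<^sup>2)"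
        by (intro sum_mono step)
      also have "\<dots> = (norm (z N))\<^sup>2 - (norm (z 0))\<^sup>2"
        by (rule sum_lessThan_telescope)
      also have "\<dots> \<le> 0"
        using N(2) by (simp add: z_def power_mono)
      finally show ?thesis by (simp add: D_def)
    qed
  qed
qed

text \<open>Row \<open>i\<close> of \<open>R = 1 + c G\<close> consists of nonnegative weights with
  sum 1, so \<open>R\<close> does not increase the maximum norm and its powers are bounded in the
  Euclidean norm. A form for \<open>R - 1 = c G\<close> also serves \<open>G\<close>, as
  \<open>c > 0\<close>.\<close>

lemma ct_interconnection_Lyapunov_form:
  fixes G :: "real^'p^'p"
  assumes "ct_interconnection G"
  obtains B :: "real^'p \<Rightarrow> real^'p \<Rightarrow> real" where
    "bilinear B" "\<And>x y. B x y = B y x" "\<And>x. x \<noteq> 0 \<Longrightarrow> 0 < B x x" "\<And>x. B x (G *v x) \<le> 0"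
proof -
  have off: "\<And>i j. i \<noteq> j \<Longrightarrow> G$i$j \<ge> 0" and diag: "\<And>i. G$i$i = - (\<Sum>j\<in>UNIV - {i}. G$i$j)"
    using assms by (auto simp: ct_interconnection_def)
  \<comment> \<open>This keeps \<open>c * \<bar>G$i$i\<bar>\<close> below 1 for every
    \<open>i\<close>; the summand 1 covers \<open>G\<close> with zero diagonal.\<close>
  define c where "c = 1 / (1 + (\<Sum>i\<in>UNIV. \<bar>G$i$i\<bar>))"
  have den: "0 < 1 + (\<Sum>i\<in>UNIV. \<bar>G$i$i\<bar>)"
    by (simp add: add_pos_nonneg sum_nonneg)
  then have c: "c > 0"
    by (simp add: c_def)
  have cdiag: "0 \<le> 1 + c * G$i$i" for i
  proof -
    have "\<bar>G$i$i\<bar> \<le> (\<Sum>i\<in>UNIV. \<bar>G$i$i\<bar>)"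
      by (rule member_le_sum) auto
    then show ?thesis
      using den by (auto simp: c_def field_simps abs_if split: if_splits)
  qed
  define R where "R = (\<lambda>v. v + c *\<^sub>R (G *v v))"
  have R: "linear R"
    by (rule linearI) (simp_all add: R_def algebra_simps matrix_vector_right_distrib
        matrix_vector_mult_scaleR)
  have comp: "\<bar>R v $ i\<bar> \<le> infnorm v" for v i
  proof -
    have "R v $ i = (1 + c * G$i$i) * v$i + (\<Sum>j\<in>UNIV - {i}. c * G$i$j * v$j)"
      by (simp add: R_def matrix_vector_mult_def sum.remove[of UNIV i] sum_distrib_left algebra_simps)
    also have "\<bar>\<dots>\<bar> \<le> (1 + c * G$i$i) * infnorm v + (\<Sum>j\<in>UNIV - {i}. c * G$i$j * infnorm v)"
      using c cdiag off
      by (intro order_trans[OF abs_triangle_ineq] add_mono order_trans[OF sum_abs] sum_mono)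
         (auto simp: abs_mult intro!: mult_left_mono component_le_infnorm_cart)
    also have "\<dots> = (1 + c * (G$i$i + (\<Sum>j\<in>UNIV - {i}. G$i$j))) * infnorm v"
      by (simp add: sum_distrib_left sum_distrib_right algebra_simps)
    also have "\<dots> = infnorm v"
      by (simp add: diag)
    finally show ?thesis .
  qed
  have contract: "infnorm (R v) \<le> infnorm v" for v
    unfolding infnorm_cart[of "R v"] using comp by (intro cSup_least) auto
  have iter: "infnorm ((R ^^ k) v) \<le> infnorm v" for k v
    by (induction k) (auto intro: order_trans[OF contract])
  have bound: "norm ((R ^^ k) v) \<le> sqrt (DIM(real^'p)) * norm v" for k v
    by (rule order_trans[OF norm_le_infnorm mult_left_mono[OF order_trans[OF iter infnorm_le_norm]]]) simp
  obtain B :: "real^'p \<Rightarrow> real^'p \<Rightarrow> real" where B: "bilinear B" "\<And>x y. B x y = B y x"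
      "\<And>x. x \<noteq> 0 \<Longrightarrow> 0 < B x x" "\<And>x. B x (R x - x) \<le> 0"
    using power_bounded_Lyapunov_form[OF R bound] by metis
  have "B x (G *v x) \<le> 0" for x
    using B(4)[of x] c by (simp add: R_def bilinear_rmul[OF B(1)] mult_le_0_iff)
  with B show thesis
    using that by blast
qed

section \<open>Boundedness of Riemann-integrable functions\<close>

lemma tagged_division_retag:
  assumes D: "D tagged_division_of I" and K: "(t, K) \<in> D" and s: "s \<in> K"
  shows "insert (s, K) (D - {(t, K)}) tagged_division_of I"
proof (rule tagged_division_ofI)
  note d = tagged_division_ofD[OF D]
  show "finite (insert (s, K) (D - {(t, K)}))"
    using d(1) by simp
  show "x \<in> L" "L \<subseteq> I" "\<exists>a b. L = cbox a b" if "(x, L) \<in> insert (s, K) (D - {(t, K)})" for x L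
    using that s K d(2-4) by blast+
  show "interior K1 \<inter> interior K2 = {}"
    if "(x1, K1) \<in> insert (s, K) (D - {(t, K)})" "(x2, K2) \<in> insert (s, K) (D - {(t, K)})"
      "(x1, K1) \<noteq> (x2, K2)" for x1 K1 x2 K2
    using that d(5)[of x1 K1 x2 K2] d(5)[OF K, of x2 K2] d(5)[of x1 K1 t K] K
    by (elim insertE DiffE) auto
  have "{L. \<exists>x. (x, L) \<in> insert (s, K) (D - {(t, K)})} = {L. \<exists>x. (x, L) \<in> D}"
    using K by blast
  then show "\<Union>{L. \<exists>x. (x, L) \<in> insert (s, K) (D - {(t, K)})} = I"
    using d(6) by simp
qed

text \<open>Moving the tag of a single cell \<open>K\<close> of a fine division changes the Riemann sum by
  \<open>content K * (f s - f t)\<close>, which must stay bounded.\<close>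

lemma riemann_integrable_on_imp_bounded:
  fixes f :: "real \<Rightarrow> 'a::real_normed_vector"
  assumes "riemann_integrable_on f a b"
  shows "bounded (f ` {a..b})"
proof -
  let ?sum = "\<lambda>D. \<Sum>(t,K)\<in>D. Henstock_Kurzweil_Integration.content K *\<^sub>R f t"
  obtain I d where d: "d > 0" and I: "\<And>D. D tagged_division_of {a..b} \<Longrightarrow>
      (\<forall>(t,K)\<in>D. diameter K < d) \<Longrightarrow> norm (?sum D - I) < 1"
    using assms unfolding riemann_integrable_on_def by (meson zero_less_one)
  \<comment> \<open>Cells inside balls of radius \<open>d/3\<close> have diameter at most
    \<open>2 * d / 3\<close>, strictly below the mesh bound.\<close>
  have "gauge (\<lambda>x::real. ball x (d/3))"
    using d by (intro gauge_ball) simp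
  then obtain D where D: "D tagged_division_of {a..b}" "(\<lambda>x. ball x (d/3)) fine D"
    by (rule fine_division_exists_real)
  have mesh: "\<forall>(t,K)\<in>D. diameter K < d"
  proof safe
    fix t K assume "(t, K) \<in> D"
    then have "diameter K \<le> diameter (ball t (d/3))"
      using D(2) by (intro diameter_subset) (auto simp: fine_def)
    also have "\<dots> < d"
      using d by simp
    finally show "diameter K < d" .
  qed
  have "bounded (f ` K)" if K: "(t, K) \<in> D" for t K
  proof -
    obtain u v where uv: "K = {u..v}"
      using tagged_division_ofD(4)[OF D(1) K] by auto
    show ?thesis
    proof (cases "u < v")
      case False
      then show ?thesis
        using uv by (cases "u = v") auto
    next
      case True
      define c where "c = Henstock_Kurzweil_Integration.content K"
      have c: "c > 0"
        using True by (simp add: c_def uv)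
      have "norm (f s) \<le> norm (f t) + 2 / c" if s: "s \<in> K" for s
      proof -
        let ?D' = "insert (s, K) (D - {(t, K)})"
        have fin: "finite D"
          using D(1) by blast
        \<comment> \<open>Two tags on the same cell would force its interior to be empty. Hence the
          retagged pair is a new summand and is not absorbed by \<open>insert\<close>.\<close>
        have "(s, K) \<notin> D - {(t, K)}"
          using tagged_division_ofD(5)[OF D(1) K, of s K] True by (auto simp: uv)
        then have sD': "?sum ?D' = c *\<^sub>R f s + ?sum (D - {(t, K)})"
          using fin by (simp add: c_def)
        have sD: "?sum D = c *\<^sub>R f t + ?sum (D - {(t, K)})"
          by (simp add: c_def sum.remove[OF fin K])
        have "norm (?sum D - I) < 1" "norm (?sum ?D' - I) < 1"
          using mesh K by (auto intro!: I D(1) tagged_division_retag[OF D(1) K s])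
        then have "norm ((?sum ?D' - I) - (?sum D - I)) < 2"
          using norm_triangle_ineq4[of "?sum ?D' - I" "?sum D - I"] by linarith
        moreover have "(?sum ?D' - I) - (?sum D - I) = c *\<^sub>R (f s - f t)"
          unfolding sD sD' by (simp add: algebra_simps)
        ultimately have "c * norm (f s - f t) < 2"
          using c by simp
        then have "norm (f s - f t) < 2 / c"
          using c by (simp add: field_simps)
        then show ?thesis
          using norm_triangle_sub[of "f s" "f t"] by simp
      qed
      then show ?thesis
        by (auto simp: bounded_iff)
    qed
  qed
  then have "bounded (\<Union>(t,K)\<in>D. f ` K)"
    using D(1) by (intro bounded_UN) (auto simp: case_prod_beta)
  moreover have "{a..b} = (\<Union>(t,K)\<in>D. K)"
    using tagged_division_ofD(6)[OF D(1)] by auto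
  ultimately show ?thesis
    by (simp add: image_UN case_prod_beta)
qed

section \<open>Rank-one decomposition of positive semidefinite matrices\<close>

lemma psd_sym_sum_rank_one:
  fixes M :: "real^'n^'n"
  assumes "psd_sym M"
  shows "\<exists>q :: 'n \<Rightarrow> real^'n. \<forall>i j. M$i$j = (\<Sum>a\<in>UNIV. q a $ i * q a $ j)"
proof -
  \<comment> \<open>Cholesky elimination: a positive pivot is removed by subtracting a rank-one matrix, and a
     zero pivot forces its whole row to vanish.\<close>
  have "\<exists>q :: 'n \<Rightarrow> real^'n. \<forall>i j. M$i$j = (\<Sum>a\<in>A. q a $ i * q a $ j)"
    if "finite A" "psd_sym M" "\<And>i j. i \<notin> A \<Longrightarrow> M$i$j = 0" for A and M :: "real^'n^'n"
    using that
  proof (induction A arbitrary: M rule: finite_induct)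
    case empty
    then show ?case by simp
  next
    case (insert k A)
    have sym: "M$i$j = M$j$i" for i j
    proof -
      have "transpose M $ i $ j = M $ i $ j"
        using insert.prems(1) by (simp add: psd_sym_def)
      then show ?thesis by (simp add: transpose_def)
    qed
    have pos: "0 \<le> v \<bullet> (M *v v)" for v
      using insert.prems(1) by (simp add: psd_sym_def)
    define m where "m = M$k$k"
    define r where "r = M$k"
    have Me: "M *v axis k 1 = r"
      by (simp add: matrix_vector_mult_basis column_def r_def vec_eq_iff sym)
    have Mv: "(M *v v) $ k = r \<bullet> v" for v
      by (simp add: matrix_vector_mul_component r_def)
    have expand: "(v + t *\<^sub>R axis k 1) \<bullet> (M *v (v + t *\<^sub>R axis k 1))
        = v \<bullet> (M *v v) + 2 * t * (r \<bullet> v) + t\<^sup>2 * m" for v t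
      by (simp add: matrix_vector_right_distrib matrix_vector_mult_scaleR Me inner_left_distrib
          inner_right_distrib inner_axis' Mv power2_eq_square)
        (simp add: r_def m_def inner_commute algebra_simps)
    have quad: "0 \<le> v \<bullet> (M *v v) + 2 * t * (r \<bullet> v) + t\<^sup>2 * m" for v t
      using pos[of "v + t *\<^sub>R axis k 1"] by (simp only: expand)
    have m0: "0 \<le> m"
      using pos[of "axis k 1"] by (simp add: Me inner_axis' r_def m_def)
    \<comment> \<open>The outer product of \<open>w\<close> with itself agrees with \<open>M\<close>
      in row and column \<open>k\<close>. For \<open>m = 0\<close> division by zero yields
      \<open>w = 0\<close>, so nothing is subtracted.\<close>
    define w where "w = (1 / sqrt m) *\<^sub>R r"
    have ww: "w$i * w$j = r$i * r$j / m" for i j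
      using m0 by (simp add: w_def)
    define M' where "M' = (\<chi> i j. M$i$j - w$i * w$j)"
    have row: "r = 0" if "m = 0"
    proof (rule ccontr)
      assume "r \<noteq> 0"
      then have rr: "r \<bullet> r > 0" by simp
      have "0 \<le> r \<bullet> (M *v r) + 2 * t * (r \<bullet> r)" for t
        using quad[of r t] that by simp
      \<comment> \<open>At this \<open>t\<close> the affine expression equals -1.\<close>
      from this[of "- (r \<bullet> (M *v r) + 1) / (2 * (r \<bullet> r))"] rr show False
        by (simp add: field_simps)
    qed
    have M'v: "v \<bullet> (M' *v v) = v \<bullet> (M *v v) - (w \<bullet> v)\<^sup>2" for v
    proof -
      have "M' *v v = M *v v - (w \<bullet> v) *\<^sub>R w"
        by (simp add: vec_eq_iff M'_def matrix_vector_mult_def inner_vec_def left_diff_distrib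
            right_diff_distrib sum_subtractf sum_distrib_left sum_distrib_right mult_ac)
      then show ?thesis
        by (simp add: inner_diff_right power2_eq_square inner_commute)
    qed
    have "psd_sym M'"
      unfolding psd_sym_def
    proof (intro conjI allI)
      show "transpose M' = M'"
        by (simp add: vec_eq_iff transpose_def M'_def sym mult.commute)
      fix v
      have "(w \<bullet> v)\<^sup>2 \<le> v \<bullet> (M *v v)"
      proof (cases "m = 0")
        case True
        then show ?thesis using pos by (simp add: w_def)
      next
        case False
        have "(w \<bullet> v)\<^sup>2 = (r \<bullet> v)\<^sup>2 / m"
          using m0 by (simp add: w_def power_divide)
        moreover have "0 \<le> v \<bullet> (M *v v) - (r \<bullet> v)\<^sup>2 / m"
          \<comment> \<open>The minimiser of the quadratic polynomial in \<open>t\<close>.\<close>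
          using quad[of v "- (r \<bullet> v) / m"] False by (simp add: power2_eq_square field_simps)
        ultimately show ?thesis by simp
      qed
      then show "0 \<le> v \<bullet> (M' *v v)"
        by (simp add: M'v)
    qed
    moreover have "M'$i$j = 0" if "i \<notin> A" for i j
    proof (cases "i = k")
      case True
      then show ?thesis
        using row by (cases "m = 0") (auto simp: M'_def ww, auto simp: r_def m_def)
    next
      case False
      with that have "M$i$l = 0" for l
        using insert.prems(2) by simp
      then show ?thesis
        using sym[of i k] by (simp add: M'_def ww r_def)
    qed
    ultimately obtain q :: "'n \<Rightarrow> real^'n" where q: "\<And>i j. M'$i$j = (\<Sum>a\<in>A. q a $ i * q a $ j)"
      using insert.IH by blast
    have "M$i$j = (\<Sum>a\<in>insert k A. (q(k := w)) a $ i * (q(k := w)) a $ j)" for i j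
    proof -
      have "(\<Sum>a\<in>A. (q(k := w)) a $ i * (q(k := w)) a $ j) = (\<Sum>a\<in>A. q a $ i * q a $ j)"
        using insert.hyps(2) by (intro sum.cong) auto
      then show ?thesis
        using insert.hyps q[of i j] by (simp add: M'_def)
    qed
    then show ?case by blast
  qed
  from this[of UNIV M] assms show ?thesis by simp
qed

section \<open>Quadratic forms along integral solutions\<close>

text \<open>Over \<open>m\<close> equal subintervals the increments add up to at most
  \<open>C * T\<^sup>2 / m\<close>, which tends to 0.\<close>

lemma nonincreasing_if_quadratic_increments:
  fixes g :: "real \<Rightarrow> real"
  assumes "T \<ge> 0"
    and incr: "\<And>a b. 0 \<le> a \<Longrightarrow> a \<le> b \<Longrightarrow> b \<le> T \<Longrightarrow> g b - g a \<le> C * (b - a)\<^sup>2"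
  shows "g T \<le> g 0"
proof -
  have bound: "g T - g 0 \<le> C * T\<^sup>2 * inverse (real (Suc n))" for n
  proof -
    define m where "m = Suc n"
    have m: "m > 0" by (simp add: m_def)
    have "g T - g 0 = (\<Sum>i<m. g (real (Suc i) * T / m) - g (real i * T / m))"
      using m by (subst sum_lessThan_telescope) simp
    also have "\<dots> \<le> (\<Sum>i<m. C * (T / m)\<^sup>2)"
    proof (intro sum_mono)
      fix i assume "i \<in> {..<m}"
      then have "real (Suc i) \<le> real m" by simp
      then have "real (Suc i) * T \<le> T * real m"
        using \<open>T \<ge> 0\<close> by (metis mult.commute mult_left_mono)
      then have "g (real (Suc i) * T / m) - g (real i * T / m)
          \<le> C * (real (Suc i) * T / m - real i * T / m)\<^sup>2"
        using \<open>T \<ge> 0\<close> m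
        by (intro incr divide_right_mono mult_right_mono) (auto simp: divide_le_eq)
      also have "real (Suc i) * T / m - real i * T / m = T / m"
        by (simp add: algebra_simps flip: diff_divide_distrib)
      finally show "g (real (Suc i) * T / m) - g (real i * T / m) \<le> C * (T / m)\<^sup>2" .
    qed
    also have "\<dots> = C * T\<^sup>2 * inverse (real m)"
      using m by (simp add: power2_eq_square field_simps)
    finally show ?thesis by (simp add: m_def)
  qed
  have "(\<lambda>n. C * T\<^sup>2 * inverse (real (Suc n))) \<longlonglongrightarrow> C * T\<^sup>2 * 0"
    by (intro tendsto_intros LIMSEQ_inverse_real_of_nat)
  then have "g T - g 0 \<le> C * T\<^sup>2 * 0"
    by (rule LIMSEQ_le_const) (use bound in blast)
  then show ?thesis by simp
qed

text \<open>The integrand need not be the derivative of \<open>x\<close> anywhere. Instead of differentiating, write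
  \<open>W (x b) (x b) - W (x a) (x a)\<close> as the integral of \<open>W (x a + x b) (f s)\<close> and compare with
  \<open>2 * W (x s) (f s) \<le> 0\<close>; the error is quadratic in \<open>b - a\<close> because \<open>f\<close> is bounded.\<close>

lemma bilinear_form_nonincreasing_along_integral:
  fixes x f :: "real \<Rightarrow> 'a::euclidean_space" and W :: "'a \<Rightarrow> 'a \<Rightarrow> real"
  assumes W: "bilinear W" and sym: "\<And>u v. W u v = W v u"
    and "T \<ge> 0"
    and integral: "\<And>t. 0 \<le> t \<Longrightarrow> t \<le> T \<Longrightarrow> (f has_integral (x t - x 0)) {0..t}"
    and bdd: "bounded (f ` {0..T})"
    and dissipative: "\<And>s. 0 \<le> s \<Longrightarrow> s \<le> T \<Longrightarrow> W (x s) (f s) \<le> 0"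
  shows "W (x T) (x T) \<le> W (x 0) (x 0)"
proof -
  obtain M where M: "M > 0" "\<And>s. 0 \<le> s \<Longrightarrow> s \<le> T \<Longrightarrow> norm (f s) \<le> M"
    using bdd by (auto simp: bounded_pos)
  obtain K where K: "K > 0" "\<And>u v. \<bar>W u v\<bar> \<le> K * norm u * norm v"
    using bilinear_bounded_pos[OF W] by auto
  have sub: "(f has_integral (x b - x a)) {a..b}" if "0 \<le> a" "a \<le> b" "b \<le> T" for a b
  proof -
    have "f integrable_on {0..b}"
      using integral[of b] that by auto
    then have int: "f integrable_on {a..b}"
      using integrable_on_subinterval[of f "{0..b}" a b] that by auto
    have "(f has_integral (x a - x 0 + integral {a..b} f)) {0..b}"
      using has_integral_combine[OF that(1,2) integral[of a] integrable_integral[OF int]] that by simp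
    then have "x b - x 0 = x a - x 0 + integral {a..b} f"
      using integral[of b] that by (intro has_integral_unique) auto
    then have "integral {a..b} f = x b - x a"
      by (simp add: algebra_simps)
    then show ?thesis
      using integrable_integral[OF int] by simp
  qed
  have lip: "norm (x b - x a) \<le> M * (b - a)" if "0 \<le> a" "a \<le> b" "b \<le> T" for a b
    using has_integral_bound[of M f "x b - x a" a b] sub[OF that] M that by simp
  show ?thesis
  proof (rule nonincreasing_if_quadratic_increments[OF \<open>T \<ge> 0\<close>, where g = "\<lambda>t. W (x t) (x t)"])
    fix a b assume ab: "0 \<le> a" "a \<le> b" "b \<le> T"
    let ?w = "x a + x b"
    have "bounded_linear (W ?w)"
      using W by (simp add: bilinear_def linear_conv_bounded_linear)
    then have "((W ?w \<circ> f) has_integral W ?w (x b - x a)) {a..b}"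
      by (rule has_integral_linear[OF sub[OF ab]])
    moreover have "((\<lambda>s. 2 * K * M\<^sup>2 * (b - a)) has_integral 2 * K * M\<^sup>2 * (b - a) * (b - a)) {a..b}"
      using has_integral_const_real[of "2 * K * M\<^sup>2 * (b - a)" a b] ab by (simp add: mult.commute)
    moreover have "(W ?w \<circ> f) s \<le> 2 * K * M\<^sup>2 * (b - a)" if s: "s \<in> {a..b}" for s
    proof -
      have "norm (?w - 2 *\<^sub>R x s) = norm ((x b - x s) - (x s - x a))"
        by (simp add: scaleR_2 algebra_simps)
      also have "\<dots> \<le> M * (b - s) + M * (s - a)"
        using lip[of s b] lip[of a s] s ab by (intro order_trans[OF norm_triangle_ineq4]) auto
      finally have w: "norm (?w - 2 *\<^sub>R x s) \<le> M * (b - a)"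
        by (simp add: algebra_simps)
      have "W ?w (f s) = W (?w - 2 *\<^sub>R x s) (f s) + 2 * W (x s) (f s)"
        by (simp add: bilinear_lsub[OF W] bilinear_lmul[OF W])
      also have "\<dots> \<le> K * norm (?w - 2 *\<^sub>R x s) * norm (f s) + 0"
        using K(2)[of "?w - 2 *\<^sub>R x s" "f s"] dissipative[of s] s ab by (intro add_mono) auto
      also have "\<dots> \<le> K * (M * (b - a)) * M + 0"
        using w M K(1) s ab by (intro add_mono mult_mono) auto
      also have "\<dots> \<le> 2 * K * M\<^sup>2 * (b - a)"
        using K(1) M(1) ab by (simp add: power2_eq_square)
      finally show ?thesis by simp
    qed
    ultimately have "W ?w (x b - x a) \<le> 2 * K * M\<^sup>2 * (b - a) * (b - a)"
      by (rule has_integral_le)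
    moreover have "W ?w (x b - x a) = W (x b) (x b) - W (x a) (x a)"
      by (simp add: bilinear_ladd[OF W] bilinear_rsub[OF W] sym[of "x a" "x b"])
    ultimately show "W (x b) (x b) - W (x a) (x a) \<le> 2 * K * M\<^sup>2 * (b - a)\<^sup>2"
      by (simp add: power2_eq_square mult.assoc)
  qed
qed

text \<open>The minimum over the compact unit sphere is attained, hence positive, and homogeneity of
  degree two extends the bound.\<close>

lemma pos_def_bilinear_lower_bound:
  fixes W :: "'a::euclidean_space \<Rightarrow> 'a \<Rightarrow> real"
  assumes W: "bilinear W" and pos: "\<And>x. x \<noteq> 0 \<Longrightarrow> 0 < W x x"
  obtains l where "l > 0" "\<And>x. l * (norm x)\<^sup>2 \<le> W x x"
proof -
  have "bounded_bilinear W"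
    using W by (simp add: bilinear_conv_bounded_bilinear)
  then have cont: "continuous_on (sphere 0 1) (\<lambda>x. W x x)"
    by (rule bounded_bilinear.continuous_on[OF _ continuous_on_id continuous_on_id])
  have "sphere 0 1 \<noteq> ({} :: 'a set)"
    by simp
  then obtain u :: 'a where u: "norm u = 1" "\<And>y. norm y = 1 \<Longrightarrow> W u u \<le> W y y"
    using continuous_attains_inf[OF compact_sphere _ cont] by auto
  show thesis
  proof
    show "W u u > 0"
      using u(1) by (intro pos) auto
    fix x :: 'a
    show "W u u * (norm x)\<^sup>2 \<le> W x x"
    proof (cases "x = 0")
      case True
      then show ?thesis by (simp add: bilinear_lzero[OF W])
    next
      case False
      have "W u u \<le> W (sgn x) (sgn x)"
        using False by (intro u) (simp add: norm_sgn)
      also have "\<dots> = W x x / (norm x)\<^sup>2"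
        by (simp add: sgn_div_norm bilinear_lmul[OF W] bilinear_rmul[OF W] power2_eq_square divide_simps)
      finally show ?thesis
        using False by (simp add: field_simps)
    qed
  qed
qed

section \<open>The Kronecker product system\<close>

text \<open>Slicing by the inner index instead of by blocks lets \<open>G\<close> act on each slice
  while \<open>Q\<close> only mixes the slices.\<close>

definition kron_component :: "'n::finite \<Rightarrow> real^('p::finite \<times> 'n) \<Rightarrow> real^'p" where
  "kron_component m x = (\<chi> i. x$(i, m))"

lemma kron_component_kron_mult:
  fixes x :: "real^('p::finite \<times> 'n::finite)"
  shows "kron_component m (kron G Q *v x) = (\<Sum>n\<in>UNIV. Q$m$n *\<^sub>R (G *v kron_component n x))"
proof -
  have "(\<Sum>c\<in>UNIV. G$i$fst c * Q$m$snd c * x$c) = (\<Sum>n\<in>UNIV. Q$m$n * (\<Sum>j\<in>UNIV. G$i$j * x$(j, n)))" for i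
  proof -
    have "(\<Sum>c\<in>UNIV. G$i$fst c * Q$m$snd c * x$c)
        = (\<Sum>j\<in>UNIV. \<Sum>n\<in>UNIV. G$i$j * Q$m$n * x$(j, n))"
      by (simp add: sum.cartesian_product case_prod_beta)
    also have "\<dots> = (\<Sum>n\<in>UNIV. \<Sum>j\<in>UNIV. G$i$j * Q$m$n * x$(j, n))"
      by (rule sum.swap)
    finally show ?thesis
      by (simp add: sum_distrib_left mult_ac)
  qed
  then show ?thesis
    by (simp add: vec_eq_iff kron_component_def kron_def matrix_vector_mult_def)
qed

text \<open>With \<open>Q = (\<Sum>a. q a (q a)\<^sup>T)\<close> the form splits into the terms \<open>B (y a) (G *v y a)\<close>, where
  \<open>y a\<close> contracts \<open>x\<close> with \<open>q a\<close>.\<close>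

lemma kron_form_nonpos:
  fixes B :: "real^'p \<Rightarrow> real^'p \<Rightarrow> real" and x :: "real^('p \<times> 'n::finite)"
  assumes B: "bilinear B" and nonpos: "\<And>y. B y (G *v y) \<le> 0" and Q: "psd_sym Q"
  shows "(\<Sum>m\<in>UNIV. B (kron_component m x) (kron_component m (kron G Q *v x))) \<le> 0"
proof -
  obtain q :: "'n \<Rightarrow> real^'n" where q: "\<And>i j. Q$i$j = (\<Sum>a\<in>UNIV. q a $ i * q a $ j)"
    using psd_sym_sum_rank_one[OF Q] by blast
  define y where "y a = (\<Sum>m\<in>UNIV. q a $ m *\<^sub>R kron_component m x)" for a
  interpret l: linear "\<lambda>u. B u v" for v using B by (simp add: bilinear_def)
  interpret r: linear "B u" for u using B by (simp add: bilinear_def)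
  let ?b = "\<lambda>m n. B (kron_component m x) (G *v kron_component n x)"
  have "(\<Sum>m\<in>UNIV. B (kron_component m x) (kron_component m (kron G Q *v x)))
      = (\<Sum>m\<in>UNIV. \<Sum>n\<in>UNIV. \<Sum>a\<in>UNIV. q a $ m * (q a $ n * ?b m n))"
    by (simp add: kron_component_kron_mult r.sum r.scale q sum_distrib_right mult.assoc)
  also have "\<dots> = (\<Sum>m\<in>UNIV. \<Sum>a\<in>UNIV. \<Sum>n\<in>UNIV. q a $ m * (q a $ n * ?b m n))"
    by (intro sum.cong refl sum.swap)
  also have "\<dots> = (\<Sum>a\<in>UNIV. \<Sum>m\<in>UNIV. \<Sum>n\<in>UNIV. q a $ m * (q a $ n * ?b m n))"
    by (rule sum.swap)
  also have "\<dots> = (\<Sum>a\<in>UNIV. B (y a) (G *v y a))"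
  proof (intro sum.cong refl)
    fix a
    have "G *v y a = (\<Sum>n\<in>UNIV. q a $ n *\<^sub>R (G *v kron_component n x))"
      by (simp add: y_def linear_sum[OF matrix_vector_mul_linear] matrix_vector_mult_scaleR)
    then have right: "B u (G *v y a) = (\<Sum>n\<in>UNIV. q a $ n * B u (G *v kron_component n x))" for u
      by (simp add: r.sum r.scale)
    have left: "B (y a) v = (\<Sum>m\<in>UNIV. q a $ m * B (kron_component m x) v)" for v
      by (simp add: y_def l.sum l.scale)
    show "(\<Sum>m\<in>UNIV. \<Sum>n\<in>UNIV. q a $ m * (q a $ n * ?b m n)) = B (y a) (G *v y a)"
      by (subst left, subst right) (simp add: sum_distrib_left)
  qed
  also have "\<dots> \<le> 0"
    by (intro sum_nonpos nonpos)
  finally show ?thesis .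
qed

text \<open>Provides the bounded integrand required by
  \<open>bilinear_form_nonincreasing_along_integral\<close>; the product is bilinear in the matrix
  \<open>Q s\<close> and the vector \<open>x s\<close>.\<close>

lemma bounded_kron_mult_image:
  fixes Q :: "'c \<Rightarrow> real^'n^'n" and x :: "'c \<Rightarrow> real^('p::finite \<times> 'n)"
  assumes "bounded (Q ` A)" "bounded (x ` A)"
  shows "bounded ((\<lambda>s. kron G (Q s) *v x s) ` A)"
proof -
  have "bilinear (\<lambda>M v. kron G M *v v :: real^('p \<times> 'n))"
    unfolding bilinear_def
    by (auto simp: kron_def matrix_vector_mult_def vec_eq_iff algebra_simps sum.distrib sum_distrib_left
        intro!: linearI)
  then obtain K where K: "K > 0" "\<And>M v. norm (kron G M *v (v :: real^('p \<times> 'n))) \<le> K * norm M * norm v"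
    using bilinear_bounded_pos by metis
  obtain a b where ab: "\<And>s. s \<in> A \<Longrightarrow> norm (Q s) \<le> a" "\<And>s. s \<in> A \<Longrightarrow> norm (x s) \<le> b"
    using assms by (auto simp: bounded_iff)
  have "norm (kron G (Q s) *v x s) \<le> K * a * b" if "s \<in> A" for s
  proof -
    have "0 \<le> a"
      using ab(1)[OF that] norm_ge_zero order_trans by blast
    then show ?thesis
      using ab[OF that] K(1) by (intro order_trans[OF K(2)] mult_mono) auto
  qed
  then show ?thesis
    by (auto simp: bounded_iff)
qed

text \<open>The equation is in integrated form because a Riemann-integrable \<open>Q\<close> may
  jump, and \<open>x\<close> need not be differentiable there. The constant is
  \<open>sqrt (u / l)\<close>, where \<open>l\<close> and \<open>u\<close> bound the form
  \<open>W\<close> from below and above; both are fixed before \<open>Q\<close> and \<open>x\<close>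
  enter.\<close>

theorem theorem1:
  fixes G :: "real^'p^'p"
  assumes "ct_interconnection G"
  shows "\<exists>\<alpha>>0. \<forall>(Q :: real \<Rightarrow> real^'n^'n) (x :: real \<Rightarrow> real^('p \<times> 'n)).
           (\<forall>t\<ge>0. psd_sym (Q t)) \<and>
           (\<forall>T\<ge>0. riemann_integrable_on Q 0 T) \<and>
           (\<forall>t\<ge>0. ((\<lambda>s. kron G (Q s) *v x s) has_integral (x t - x 0)) {0..t})
           \<longrightarrow> (\<forall>t\<ge>0. norm (x t) \<le> \<alpha> * norm (x 0))"
proof -
  obtain B :: "real^'p \<Rightarrow> real^'p \<Rightarrow> real" where B: "bilinear B" "\<And>x y. B x y = B y x"
      "\<And>x. x \<noteq> 0 \<Longrightarrow> 0 < B x x" "\<And>x. B x (G *v x) \<le> 0"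
    using ct_interconnection_Lyapunov_form[OF assms] by metis
  \<comment> \<open>This is \<open>B \<otimes> 1\<close>: the form \<open>B\<close> applied slice by
    slice.\<close>
  define W where "W = (\<lambda>x y :: real^('p \<times> 'n). \<Sum>m\<in>UNIV. B (kron_component m x) (kron_component m y))"
  have comp: "kron_component m (x + y) = kron_component m x + kron_component m y"
      "kron_component m (c *\<^sub>R x) = c *\<^sub>R kron_component m x"
    for m :: 'n and x y :: "real^('p \<times> 'n)" and c
    by (simp_all add: kron_component_def vec_eq_iff)
  have W: "bilinear W"
    unfolding bilinear_def
    by (auto simp: W_def comp bilinear_ladd[OF B(1)] bilinear_radd[OF B(1)] bilinear_lmul[OF B(1)]
        bilinear_rmul[OF B(1)] sum.distrib sum_distrib_left intro!: linearI)
  have W_sym: "W x y = W y x" for x y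
    by (simp add: W_def B(2))
  have B_nonneg: "0 \<le> B u u" for u
    using B(3)[of u] by (cases "u = 0") (auto simp: bilinear_lzero[OF B(1)])
  have W_pos: "0 < W x x" if "x \<noteq> 0" for x
  proof -
    have "\<exists>c. x$c \<noteq> 0"
      using that by (metis vec_eq_iff zero_index)
    then obtain i m where "x$(i, m) \<noteq> 0"
      by auto
    then have "kron_component m x \<noteq> 0"
      by (metis kron_component_def vec_lambda_beta zero_index)
    then show ?thesis
      unfolding W_def by (intro sum_pos2[of _ m] B B_nonneg) auto
  qed
  obtain l where l: "l > 0" "\<And>x. l * (norm x)\<^sup>2 \<le> W x x"
    using pos_def_bilinear_lower_bound[OF W W_pos] by metis
  obtain u where u: "u > 0" "\<And>x y. \<bar>W x y\<bar> \<le> u * norm x * norm y"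
    using bilinear_bounded_pos[OF W] by auto
  have "norm (x T) \<le> sqrt (u / l) * norm (x 0)"
    if Q: "\<forall>t\<ge>0. psd_sym (Q t)" and int: "\<forall>T\<ge>0. riemann_integrable_on Q 0 T"
      and sol: "\<forall>t\<ge>0. ((\<lambda>s. kron G (Q s) *v x s) has_integral (x t - x 0)) {0..t}" and T: "T \<ge> 0"
    for Q :: "real \<Rightarrow> real^'n^'n" and x :: "real \<Rightarrow> real^('p \<times> 'n)" and T
  proof -
    let ?f = "\<lambda>s. kron G (Q s) *v x s"
    \<comment> \<open>Being an indefinite integral, \<open>x\<close> is continuous and so bounded on
      \<open>{0..T}\<close>; with \<open>Q\<close> bounded, the integrand is bounded too.\<close>
    have "continuous_on {0..T} (\<lambda>t. x 0 + integral {0..t} ?f)"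
      using sol T by (intro continuous_intros indefinite_integral_continuous_1) auto
    moreover have "x 0 + integral {0..t} ?f = x t" if "t \<in> {0..T}" for t
      using integral_unique[OF sol[rule_format, of t]] that by simp
    ultimately have "continuous_on {0..T} x"
      by (rule continuous_on_eq)
    then have "bounded (x ` {0..T})"
      by (intro compact_imp_bounded compact_continuous_image) auto
    moreover have "bounded (Q ` {0..T})"
      using int T by (intro riemann_integrable_on_imp_bounded) auto
    ultimately have bdd: "bounded (?f ` {0..T})"
      by (intro bounded_kron_mult_image)
    have "W (x T) (x T) \<le> W (x 0) (x 0)"
    proof (rule bilinear_form_nonincreasing_along_integral[OF W W_sym T _ bdd])
      show "W (x s) (?f s) \<le> 0" if "0 \<le> s" for s
        unfolding W_def using Q that by (intro kron_form_nonpos B) auto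
    qed (use sol in auto)
    then have "l * (norm (x T))\<^sup>2 \<le> u * (norm (x 0))\<^sup>2"
      using l(2)[of "x T"] u(2)[of "x 0" "x 0"] by (simp add: power2_eq_square mult.assoc)
    then have "(norm (x T))\<^sup>2 \<le> u / l * (norm (x 0))\<^sup>2"
      using l(1) by (simp add: field_simps)
    then have "norm (x T) \<le> sqrt (u / l * (norm (x 0))\<^sup>2)"
      by (rule real_le_rsqrt)
    then show ?thesis
      by (simp add: real_sqrt_mult real_sqrt_divide)
  qed
  then show ?thesis
    using l(1) u(1) by (intro exI[of _ "sqrt (u / l)"]) auto
qed

end
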